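(* Let $(L,\wedge,\vee,{}^{\triangle},{}^{\nabla},0,1)$ be a weakly dicomplemented lattice. Then $x^{\triangle}=x^{\nabla}$ for all $x\in L$ if and only if both $(L,\wedge,\vee,{}^{\triangle},0,1)$ and $(L,\wedge,\vee,{}^{\nabla},0,1)$ are Boolean algebras (with ${}^{\triangle}$, respectively ${}^{\nabla}$, as the complementation).
   Context: A weakly dicomplemented lattice is a bounded lattice $(L,\wedge,\vee,0,1)$ equipped with two unary operations ${}^{\triangle}$ and ${}^{\nabla}$ such that for all $x,y\in L$: (1) $x^{\triangle\triangle}\le x$; (2) $x\le y\implies x^{\triangle}\ge y^{\triangle}$; (3) $(x\wedge y)\vee(x\wedge y^{\triangle})=x$; (1') $x^{\nabla\nabla}\ge x$; (2') $x\le y\implies x^{\nabla}\ge y^{\nabla}$; (3') $(x\vee y)\wedge(x\vee y^{\nabla})=x$. Here $x^{\triangle\triangle}=(x^{\triangle})^{\triangle}$ and $x^{\nabla\nabla}=(x^{\nabla})^{\nabla}$. *)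

theory Defs
  imports Main
begin

(* The carrier L is the whole type, with inf, sup, bot, top as meet, join, 0, 1.
   tri is the weak complementation, nab the dual weak complementation. *)
locale weakly_dicomplemented_lattice =
  fixes tri nab :: "'a::bounded_lattice \<Rightarrow> 'a"
  assumes tri_tri_le: "tri (tri x) \<le> x"
    and tri_antimono: "x \<le> y \<Longrightarrow> tri x \<ge> tri y"
    and tri_cases: "sup (inf x y) (inf x (tri y)) = x"
    and nab_nab_ge: "nab (nab x) \<ge> x"
    and nab_antimono: "x \<le> y \<Longrightarrow> nab x \<ge> nab y"
    and nab_cases: "inf (sup x y) (sup x (nab y)) = x"

end

theory Submission
  imports Defs
begin

text \<open>If both operations agree, they form an antitone involution under which every element has
  a complement, and axiom (3) turns \<open>x \<sqinter> y = \<bottom>\<close> into \<open>x \<le> y\<^sup>\<triangle>\<close>. Such a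
  pseudocomplementation forces distributivity: an element \<open>t\<close> below both \<open>x \<sqinter> (y \<squnion> z)\<close> and the
  complement of \<open>(x \<sqinter> y) \<squnion> (x \<sqinter> z)\<close> is disjoint from \<open>y\<close> and from \<open>z\<close>, hence from \<open>y \<squnion> z\<close>,
  and is therefore \<open>\<bottom>\<close>. The converse is uniqueness of complements in a Boolean algebra.\<close>

context weakly_dicomplemented_lattice
begin

lemma sup_tri_eq_top: "sup x (tri x) = top"
  using tri_cases[of top x] by simp

lemma inf_nab_eq_bot: "inf x (nab x) = bot"
  using nab_cases[of bot x] by simp

lemma le_tri_if_inf_eq_bot: "x \<le> tri y" if "inf x y = bot"
proof -
  have "inf x (tri y) = x"
    using tri_cases[of x y] that by simp
  then show ?thesis
    by (simp add: le_iff_inf)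
qed

text \<open>The relation \<open>t \<le> tri y\<close> is symmetric here: it gives
  \<open>tri (tri y) \<le> tri t\<close>, and
  \<open>y \<le> nab (nab y) = tri (tri y)\<close>.\<close>

lemma sup_le_tri_if_le_tri:
  assumes "\<And>x. tri x = nab x" "t \<le> tri y" "t \<le> tri z"
  shows "sup y z \<le> tri t"
proof (rule sup_least)
  show "y \<le> tri t"
    using tri_antimono[OF assms(2)] nab_nab_ge[of y] assms(1) by (metis order_trans)
  show "z \<le> tri t"
    using tri_antimono[OF assms(3)] nab_nab_ge[of z] assms(1) by (metis order_trans)
qed

lemma inf_sup_distrib_if_tri_eq_nab:
  fixes x y z :: 'a
  assumes eq: "\<And>x. tri x = nab x"
  shows "inf x (sup y z) = sup (inf x y) (inf x z)"
proof (rule order_antisym)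
  define d where "d = sup (inf x y) (inf x z)"
  define t where "t = inf (inf x (sup y z)) (tri d)"
  have disjoint: "inf u (tri u) = bot" for u
    using inf_nab_eq_bot eq by simp
  have t: "t \<le> x" "t \<le> sup y z" "t \<le> tri d"
    by (auto simp: t_def intro: le_infI1)
  \<comment> \<open>Used for \<open>u = y\<close> and \<open>u = z\<close>, whose meets with
    \<open>x\<close> are the two joinands of \<open>d\<close>.\<close>
  have "inf t u = bot" if "inf x u \<le> d" for u
  proof -
    have "inf t u \<le> d"
      using t(1) that by (meson inf_mono order_refl order_trans)
    moreover have "inf t u \<le> tri d"
      using t(3) by (rule le_infI1)
    ultimately have "inf t u \<le> inf d (tri d)"
      by simp
    then show ?thesis
      by (simp add: disjoint bot_unique)
  qed
  then have "t \<le> tri y" "t \<le> tri z"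
    by (simp_all add: d_def le_tri_if_inf_eq_bot)
  \<comment> \<open>Here \<open>t \<le> sup y z \<le> tri t\<close>, so \<open>t\<close> is disjoint
    from itself.\<close>
  then have "t \<le> tri t"
    using sup_le_tri_if_le_tri[OF eq] t(2) order_trans by blast
  then have "t = bot"
    using disjoint[of t] by (simp add: inf_absorb1)
  \<comment> \<open>By definition of \<open>t\<close>, \<open>t = bot\<close> says that
    \<open>inf x (sup y z)\<close> is disjoint from \<open>tri d\<close>.\<close>
  then have "inf x (sup y z) \<le> tri (tri d)"
    unfolding t_def by (rule le_tri_if_inf_eq_bot)
  then show "inf x (sup y z) \<le> sup (inf x y) (inf x z)"
    using tri_tri_le[of d] unfolding d_def by (rule order_trans)
  show "sup (inf x y) (inf x z) \<le> inf x (sup y z)"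
    by (rule distrib_inf_le)
qed

lemma boolean_if_tri_eq_nab:
  assumes eq: "\<And>x. tri x = nab x"
  shows "abstract_boolean_algebra inf sup tri bot top"
proof
  have inf_distrib: "inf x (sup y z) = sup (inf x y) (inf x z)" for x y z :: 'a
    by (rule inf_sup_distrib_if_tri_eq_nab[OF eq])
  then show "inf x (sup y z) = sup (inf x y) (inf x z)" for x y z :: 'a .
  show "sup x (inf y z) = inf (sup x y) (sup x z)" for x y z :: 'a
    using inf_distrib by (rule distrib_imp1)
  show "inf x top = x" "sup x bot = x" for x :: 'a
    by simp_all
  show "inf x (tri x) = bot" for x
    using inf_nab_eq_bot eq by simp
  show "sup x (tri x) = top" for x
    by (rule sup_tri_eq_top)
qed

end

theorem theorem2:
  fixes tri nab :: "'a::bounded_lattice \<Rightarrow> 'a"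
  assumes "weakly_dicomplemented_lattice tri nab"
  shows "(\<forall>x. tri x = nab x) \<longleftrightarrow>
    abstract_boolean_algebra (inf :: 'a \<Rightarrow> 'a \<Rightarrow> 'a) sup tri bot top \<and>
    abstract_boolean_algebra (inf :: 'a \<Rightarrow> 'a \<Rightarrow> 'a) sup nab bot top"
proof
  interpret weakly_dicomplemented_lattice tri nab
    by (rule assms)
  assume eq: "\<forall>x. tri x = nab x"
  then have "tri = nab"
    by blast
  then show "abstract_boolean_algebra (inf :: 'a \<Rightarrow> 'a \<Rightarrow> 'a) sup tri bot top \<and>
    abstract_boolean_algebra (inf :: 'a \<Rightarrow> 'a \<Rightarrow> 'a) sup nab bot top"
    using boolean_if_tri_eq_nab eq by simp
next
  assume both: "abstract_boolean_algebra (inf :: 'a \<Rightarrow> 'a \<Rightarrow> 'a) sup tri bot top \<and>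
    abstract_boolean_algebra (inf :: 'a \<Rightarrow> 'a \<Rightarrow> 'a) sup nab bot top"
  then interpret T: abstract_boolean_algebra "inf :: 'a \<Rightarrow> 'a \<Rightarrow> 'a" sup tri bot top
    by blast
  interpret N: abstract_boolean_algebra "inf :: 'a \<Rightarrow> 'a \<Rightarrow> 'a" sup nab bot top
    using both by blast
  show "\<forall>x. tri x = nab x"
    \<comment> \<open>Both algebras share the lattice operations and bounds, so \<open>nab x\<close>
      is also a complement of \<open>x\<close> in \<open>T\<close>.\<close>
    using T.compl_unique N.conj_cancel_right N.disj_cancel_right by blast
qed

end
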